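(* Let $m\ge1$ be an integer, $t_1,\dots,t_m\in\mathbb{R}$ with $t_m>0$, and let $\lambda=-\frac12$. Define $$A_k=\frac{t_k\Gamma(k+\frac12)}{\Gamma(\frac12)\Gamma(k)},\qquad k=1,2,\dots,m,$$ and, for $n$ sufficiently large, let $u=u(n)$ be the unique positive solution of $$\sum_{k=1}^mA_ku^k=n.$$ Then the recurrence coefficient $\beta_n$ satisfies $$\beta_n=\frac u4\Bigl(1+\mathcal{O}\Bigl(\frac1n\Bigr)\Bigr),\qquad n\to\infty,$$ and the coefficients $a_i$, $i=1,2,\dots,m-2$, of the asymptotic expansion $\beta_n\sim\bigl(\frac{n}{4^mA_m}\bigr)^{1/m}\bigl(1+\sum_{i=1}^\infty a_in^{-i/m}\bigr)$ can be determined recursively from the equation $\sum_{k=1}^mA_ku^k=n$.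
   Context: Here $w(x)=\exp(-\sum_{k=1}^m t_kx^{2k})$ (the weight $|x|^{2\lambda+1}\exp(-\sum_{k=1}^mt_kx^{2k})$ with $\lambda=-\frac12$), $P_n$ are the monic polynomials orthogonal with respect to $w\,dx$ on $\mathbb{R}$, and $\beta_n$ is defined by $xP_n=P_{n+1}+\beta_nP_{n-1}$, $P_0=1$, $P_{-1}=0$. It is known (Deift et al.) that for $\lambda=-\frac12$ the expansion $\beta_n\sim\bigl(\frac{n}{4^mA_m}\bigr)^{1/m}\bigl(1+\sum_{i=1}^\infty a_in^{-i/m}\bigr)$ holds as $n\to\infty$ for some constants $a_i$. *)

theory Defs
  imports
    "HOL-Analysis.Analysis"
    "HOL-Library.Landau_Symbols"
    "HOL-Computational_Algebra.Computational_Algebra"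
begin

definition weight :: "nat \<Rightarrow> (nat \<Rightarrow> real) \<Rightarrow> real \<Rightarrow> real" where
  "weight m t x = exp (- (\<Sum>k=1..m. t k * x ^ (2 * k)))"

definition monic_orthogonal :: "(real \<Rightarrow> real) \<Rightarrow> (nat \<Rightarrow> real poly) \<Rightarrow> bool" where
  "monic_orthogonal w P \<longleftrightarrow>
     (\<forall>n. degree (P n) = n \<and> lead_coeff (P n) = 1) \<and>
     (\<forall>i j. i \<noteq> j \<longrightarrow> (LINT x|lborel. poly (P i) x * poly (P j) x * w x) = 0)"

text \<open>The convention \<open>P\<^sub>-\<^sub>1 = 0\<close> leaves \<open>\<beta> 0\<close> unconstrained.\<close>

definition recurrence_coeffs :: "(nat \<Rightarrow> real poly) \<Rightarrow> (nat \<Rightarrow> real) \<Rightarrow> bool" where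
  "recurrence_coeffs P \<beta> \<longleftrightarrow>
     (\<forall>n. [:0, 1:] * P n = P (n + 1) + smult (\<beta> n) (if n = 0 then 0 else P (n - 1)))"

definition A :: "(nat \<Rightarrow> real) \<Rightarrow> nat \<Rightarrow> real" where
  "A t k = t k * Gamma (real k + 1/2) / (Gamma (1/2) * Gamma (real k))"

definition u_sol :: "nat \<Rightarrow> (nat \<Rightarrow> real) \<Rightarrow> nat \<Rightarrow> real" where
  "u_sol m t n = (THE u. u > 0 \<and> (\<Sum>k=1..m. A t k * u ^ k) = real n)"

text \<open>Poincare asymptotic expansion
  \<open>\<beta>\<^sub>n \<sim> (n / (4^m A\<^sub>m))^(1/m) (1 + \<Sum>i\<ge>1. a\<^sub>i n^(-i/m))\<close>; the value \<open>a 0\<close> plays no role.\<close>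

definition has_expansion :: "nat \<Rightarrow> (nat \<Rightarrow> real) \<Rightarrow> (nat \<Rightarrow> real) \<Rightarrow> (nat \<Rightarrow> real) \<Rightarrow> bool" where
  "has_expansion m t \<beta> a \<longleftrightarrow>
     (\<forall>N. (\<lambda>n. \<beta> n / (real n / (4 ^ m * A t m)) powr (1 / real m)
               - (1 + (\<Sum>i=1..N. a i * real n powr (- real i / real m))))
          \<in> O(\<lambda>n. real n powr (- real (N + 1) / real m)))"

text \<open>The partial expansion of \<open>u = 4\<beta>\<close> with coefficients \<open>a 1, \<dots>, a (j - 1)\<close> and a trial
  coefficient \<open>x\<close> in place of \<open>a j\<close>; note \<open>4 (n / (4^m A\<^sub>m))^(1/m) = (n / A\<^sub>m)^(1/m)\<close>.\<close>

definition u_partial ::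
    "nat \<Rightarrow> (nat \<Rightarrow> real) \<Rightarrow> (nat \<Rightarrow> real) \<Rightarrow> nat \<Rightarrow> real \<Rightarrow> nat \<Rightarrow> real" where
  "u_partial m t a j x n = (real n / A t m) powr (1 / real m) *
     (1 + (\<Sum>i=1..<j. a i * real n powr (- real i / real m)) + x * real n powr (- real j / real m))"

text \<open>Formal substitution of \<open>u = (n / A\<^sub>m)^(1/m) F(s)\<close> with \<open>s = n^(-1/m)\<close> into
  \<open>(\<Sum>k=1..m. A\<^sub>k u^k) / n\<close>: since \<open>n^(k/m) / n = s^(m-k)\<close>, the equation for \<open>u\<close> becomes
  \<open>eq_series m t F = 1\<close>.\<close>

definition eq_series :: "nat \<Rightarrow> (nat \<Rightarrow> real) \<Rightarrow> real fps \<Rightarrow> real fps" where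
  "eq_series m t F =
     (\<Sum>k=1..m. fps_const (A t k * A t m powr (- real k / real m)) * fps_X ^ (m - k) * F ^ k)"

end

(* Integrating (P n * P (n - 1) * w)' over the line gives the string equation
     n = sum_k 2 k t_k c_k(n),
   where c_k(n) is the coefficient of P (n - 1) in x^(2k-1) P n, i.e. a sum over lattice paths of
   products of k values of beta at indices near n. The expansion, taken up to order 1/n, shows that
   beta (n + s) / beta n = 1 + O(1/n). So each c_k(n) is (2k-1 choose k) beta(n)^k (1 + O(1/n)), and
   since 2 k t_k (2k-1 choose k) = 4^k A_k, the number v = 4 beta(n) satisfies sum_k A_k v^k = n + O(1).
   For large arguments this polynomial minus a small multiple of u^m is still monotone, which turns
   the O(1) residual into v^m = u^m (1 + O(1/n)).
   For the coefficients, the same residual bound says that a polynomial in s = n^(-1/m) is O(s^m).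
   Its coefficients below s^m therefore vanish, and the coefficient of s^j is m a_j plus a term
   depending on a_1, ..., a_(j-1) only. *)
theory Submission
  imports Defs "HOL-Probability.Distributions" "HOL-Real_Asymp.Real_Asymp"
begin

subsection \<open>Orthogonal polynomials and the string equation\<close>

lemma integrable_power_gauss:
  fixes c :: real
  assumes "c > 0"
  shows "integrable lborel (\<lambda>x. x ^ k * exp (- (c * x\<^sup>2)))"
proof -
  \<comment> \<open>The variance 1/(2c) makes the normal density proportional to exp(-c x^2), so
    known normal moments apply.\<close>
  define \<sigma> where "\<sigma> = sqrt (1 / (2 * c))"
  have \<sigma>: "\<sigma> > 0" "\<sigma>\<^sup>2 = 1 / (2 * c)" using assms by (simp_all add: \<sigma>_def)
  have "integrable lborel (\<lambda>x. sqrt (2 * pi * \<sigma>\<^sup>2) * (normal_density 0 \<sigma> x * (x - 0) ^ k))"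
    by (intro integrable_mult_right integrable_normal_moment) (use \<sigma> in auto)
  also have "(\<lambda>x. sqrt (2 * pi * \<sigma>\<^sup>2) * (normal_density 0 \<sigma> x * (x - 0) ^ k))
      = (\<lambda>x. x ^ k * exp (- (c * x\<^sup>2)))"
    using assms by (auto simp: normal_density_def \<sigma>(2) field_simps)
  finally show ?thesis .
qed

text \<open>Quadratic growth of \<open>V\<close> puts exp(-V) below a multiple of a Gaussian. This
  gives finite moments and makes boundary terms vanish.\<close>

locale exp_weight =
  fixes V :: "real poly"
  assumes growth: "\<exists>c>0. \<exists>C. \<forall>x. c * x\<^sup>2 - C \<le> poly V x"
begin

definition L :: "real poly \<Rightarrow> real" where
  "L q = (LINT x|lborel. poly q x * exp (- poly V x))"

lemma weight_bound:
  obtains c C where "c > 0" "C > 0" "\<And>x. exp (- poly V x) \<le> C * exp (- (c * x\<^sup>2))"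
proof -
  obtain c C where c: "c > 0" and le: "\<And>x. c * x\<^sup>2 - C \<le> poly V x"
    using growth by blast
  have "exp (- poly V x) \<le> exp C * exp (- (c * x\<^sup>2))" for x
    using le[of x] by (simp flip: exp_add)
  then show ?thesis using that c by (metis exp_gt_zero)
qed

lemma integrable_poly_weight [simp]: "integrable lborel (\<lambda>x. poly q x * exp (- poly V x))"
proof -
  obtain c C where c: "c > 0" "C > 0" "\<And>x. exp (- poly V x) \<le> C * exp (- (c * x\<^sup>2))"
    using weight_bound by blast
  have "integrable lborel (\<lambda>x. C * (\<Sum>i\<le>degree q. coeff q i * (x ^ i * exp (- (c * x\<^sup>2)))))"
    by (intro integrable_mult_right Bochner_Integration.integrable_sum integrable_power_gauss c)
  also have "(\<lambda>x. C * (\<Sum>i\<le>degree q. coeff q i * (x ^ i * exp (- (c * x\<^sup>2)))))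
      = (\<lambda>x. poly q x * (C * exp (- (c * x\<^sup>2))))"
    by (auto simp: poly_altdef sum_distrib_left sum_distrib_right mult_ac)
  finally show ?thesis
    by (rule Bochner_Integration.integrable_bound)
      (use c in \<open>auto simp: abs_mult intro!: borel_measurable_continuous_onI continuous_intros mult_left_mono order.trans[OF c(3)] AE_I2\<close>)
qed

text \<open>The Gaussian bound depends on |x| only, so a filter along which |x| tends to infinity
  covers both ends of the line.\<close>

lemma poly_weight_tendsto_0:
  assumes "filterlim (\<lambda>x. \<bar>x\<bar>) at_top F"
  shows "((\<lambda>x. poly q x * exp (- poly V x)) \<longlongrightarrow> 0) F"
proof -
  obtain c C where c: "c > 0" "C > 0" "\<And>x. exp (- poly V x) \<le> C * exp (- (c * x\<^sup>2))"
    using weight_bound by blast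
  have lim: "((\<lambda>x. x ^ k * exp (- (c * x\<^sup>2))) \<longlongrightarrow> 0) at_top" for k :: nat
    using \<open>c > 0\<close> by real_asymp
  have "((\<lambda>x. C * (\<Sum>i\<le>degree q. \<bar>coeff q i\<bar> * (\<bar>x\<bar> ^ i * exp (- (c * \<bar>x\<bar>\<^sup>2)))))
      \<longlongrightarrow> C * (\<Sum>i\<le>degree q. \<bar>coeff q i\<bar> * 0)) F"
    by (intro tendsto_intros filterlim_compose[OF lim assms])
  then have *: "((\<lambda>x. C * (\<Sum>i\<le>degree q. \<bar>coeff q i\<bar> * (\<bar>x\<bar> ^ i * exp (- (c * \<bar>x\<bar>\<^sup>2)))))
      \<longlongrightarrow> 0) F" by simp
  have "norm (poly q x * exp (- poly V x))
      \<le> C * (\<Sum>i\<le>degree q. \<bar>coeff q i\<bar> * (\<bar>x\<bar> ^ i * exp (- (c * \<bar>x\<bar>\<^sup>2))))" for x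
  proof -
    have "\<bar>poly q x\<bar> \<le> (\<Sum>i\<le>degree q. \<bar>coeff q i\<bar> * \<bar>x\<bar> ^ i)"
      unfolding poly_altdef by (rule order.trans[OF sum_abs]) (simp add: abs_mult power_abs)
    then have "\<bar>poly q x\<bar> * exp (- poly V x)
        \<le> (\<Sum>i\<le>degree q. \<bar>coeff q i\<bar> * \<bar>x\<bar> ^ i) * (C * exp (- (c * x\<^sup>2)))"
      by (intro mult_mono c) (auto intro: sum_nonneg)
    then show ?thesis
      by (simp add: abs_mult sum_distrib_left sum_distrib_right mult_ac)
  qed
  then show ?thesis
    by (intro Lim_null_comparison[OF _ *]) auto
qed

lemma L_add: "L (p + q) = L p + L q"
  by (simp add: L_def distrib_right)

lemma L_smult: "L (smult c p) = c * L p"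
  by (simp add: L_def mult.assoc)

lemma L_0 [simp]: "L 0 = 0"
  by (simp add: L_def)

lemma L_sum: "L (\<Sum>i\<in>I. f i) = (\<Sum>i\<in>I. L (f i))"
  by (induction I rule: infinite_finite_induct) (auto simp: L_add)

lemma L_diff: "L (p - q) = L p - L q"
  using L_add[of p "smult (-1) q"] L_smult[of "-1" q] by simp

text \<open>Integration by parts: q exp(-V) vanishes at both ends, so its derivative (q' - V' q)
  exp(-V) has integral 0.\<close>

lemma L_pderiv: "L (pderiv q) = L (pderiv V * q)"
proof -
  let ?F = "\<lambda>x. poly q x * exp (- poly V x)"
  let ?f = "\<lambda>x. poly (pderiv q - pderiv V * q) x * exp (- poly V x)"
  have "(LBINT x=-\<infinity>..\<infinity>. ?f x) = 0 - 0"
  proof (rule interval_integral_FTC_integrable)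
    show "(?F has_vector_derivative ?f x) (at x)" for x
      unfolding has_real_derivative_iff_has_vector_derivative[symmetric]
      by (auto intro!: derivative_eq_intros simp: algebra_simps)
    show "isCont ?f x" for x by (intro continuous_intros)
    show "set_integrable lborel (einterval (-\<infinity>) \<infinity>) ?f"
      by (simp add: einterval_eq_UNIV set_integrable_def del: poly_diff)
    show "((?F \<circ> real_of_ereal) \<longlongrightarrow> 0) (at_right (-\<infinity>))"
      unfolding at_right_MInf filterlim_filtermap o_def
      by (simp, rule poly_weight_tendsto_0) real_asymp
    show "((?F \<circ> real_of_ereal) \<longlongrightarrow> 0) (at_left \<infinity>)"
      unfolding at_left_PInf filterlim_filtermap o_def
      by (simp add: poly_weight_tendsto_0 filterlim_abs_real)
  qed auto
  then have "L (pderiv q - pderiv V * q) = 0"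
    by (simp add: L_def interval_lebesgue_integral_def einterval_eq_UNIV set_lebesgue_integral_def)
  then show ?thesis by (simp add: L_diff)
qed

text \<open>A nonnegative integrand with integral 0 vanishes almost everywhere, whereas a nonzero
  \<open>q\<close> has finitely many roots.\<close>

lemma L_square_pos:
  assumes "q \<noteq> 0"
  shows "L (q * q) > 0"
proof -
  have nn: "0 \<le> L (q * q)" unfolding L_def by (intro Bochner_Integration.integral_nonneg) auto
  have "L (q * q) \<noteq> 0"
  proof
    assume "L (q * q) = 0"
    then have "AE x in lborel. poly (q * q) x * exp (- poly V x) = 0"
      unfolding L_def by (subst (asm) integral_nonneg_eq_0_iff_AE) (auto simp del: poly_mult intro!: AE_I2, auto)
    moreover have "AE x in lborel. x \<notin> {x. poly q x = 0}"
      by (intro AE_not_in finite_imp_null_set_lborel poly_roots_finite assms)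
    ultimately have "AE x in (lborel :: real measure). False" by eventually_elim auto
    then show False
      using ae_filter_eq_bot_iff[of "lborel :: real measure"] by (simp add: trivial_limit_def)
  qed
  with nn show ?thesis by simp
qed

end

section \<open>Lattice paths generated by the three-term recurrence\<close>

text \<open>The total weight of the lattice paths from height \<open>n + e\<close> to height \<open>n + r\<close> with \<open>r\<close> up-steps of
  weight 1 and \<open>e\<close> down-steps, where a down-step from height \<open>i\<close> has weight \<open>\<beta> i\<close>. Measuring heights
  from \<open>n\<close> avoids truncated subtraction.\<close>

context
  fixes \<beta> :: "nat \<Rightarrow> real"
begin

fun path_weight :: "nat \<Rightarrow> nat \<Rightarrow> nat \<Rightarrow> real" where
  "path_weight r 0 n = 1"
| "path_weight 0 (Suc e) n = \<beta> (n + e + 1) * path_weight 0 e n"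
| "path_weight (Suc r) (Suc e) n =
     path_weight r (Suc e) (n + 1) + \<beta> (n + e + 1) * path_weight (Suc r) e n"

end

text \<open>Rewrite rules that absorb a single factor X into a power of X, in the two product shapes
  met when the recurrence is multiplied out.\<close>

lemma monom_mult_X: "monom 1 e * (monom 1 (Suc 0) * p) = monom 1 (Suc e) * (p :: real poly)"
    "monom 1 (Suc 0) * (p * (q * monom 1 e)) = p * (q * monom 1 (Suc e) :: real poly)"
proof -
  have *: "monom 1 (Suc e) = monom 1 e * (monom 1 (Suc 0) :: real poly)"
    by (simp add: mult_monom)
  show "monom 1 e * (monom 1 (Suc 0) * p) = monom 1 (Suc e) * p"
    and "monom 1 (Suc 0) * (p * (q * monom 1 e)) = p * (q * monom 1 (Suc e))"
    by (simp_all only: * mult_ac)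
qed

locale freud = exp_weight V for V +
  fixes P :: "nat \<Rightarrow> real poly" and \<beta> :: "nat \<Rightarrow> real"
  assumes degree_P: "degree (P n) = n"
    and monic_P: "lead_coeff (P n) = 1"
    and orth_P: "i \<noteq> j \<Longrightarrow> L (P i * P j) = 0"
    and recurrence: "recurrence_coeffs P \<beta>"
begin

definition h :: "nat \<Rightarrow> real" where
  "h n = L (P n * P n)"

lemma coeff_P_self [simp]: "coeff (P n) n = 1"
  using degree_P[of n] monic_P[of n] by simp

lemma h_pos: "h n > 0"
  unfolding h_def using coeff_P_self[of n] by (intro L_square_pos) force

text \<open>Removing leading terms one by one expands \<open>q\<close> in the orthogonal basis. Only
  the component along \<open>P n\<close> survives, and as \<open>P n\<close> is monic its
  coefficient is that of x^n in \<open>q\<close>.\<close>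

lemma L_mult_P_of_degree_le:
  assumes "degree q \<le> n"
  shows "L (q * P n) = coeff q n * h n"
proof -
  \<comment> \<open>The degree bound \<open>d\<close> is kept apart from \<open>n\<close>, so that
    it varies in the induction while \<open>n\<close> stays fixed.\<close>
  have "L (q * P n) = coeff q n * h n" if "degree q \<le> d" "d \<le> n" for d
    using that
  proof (induction d arbitrary: q)
    case 0
    then obtain c where q: "q = [:c:]" by (auto elim: degree_eq_zeroE)
    have P0: "P 0 = 1"
      using degree_P[of 0] coeff_P_self[of 0] by (metis degree_eq_zeroE coeff_pCons_0 pCons_one)
    have "L (q * P n) = c * L (P 0 * P n)" by (simp add: q P0 L_smult)
    then show ?case using orth_P[of 0 n] by (cases n) (auto simp: q h_def P0)
  next
    case (Suc d)
    define c where "c = coeff q (Suc d)"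
    define r where "r = q - smult c (P (Suc d))"
    have "degree r \<le> d"
    proof (rule degree_le, intro allI impI)
      fix i assume "d < i"
      then show "coeff r i = 0"
        using Suc.prems(1) degree_P[of "Suc d"] 
        by (cases "i = Suc d") (auto simp: r_def c_def coeff_eq_0)
    qed
    moreover from this have "coeff r n = 0" using Suc.prems(2) by (simp add: coeff_eq_0)
    ultimately have "L (r * P n) = 0" using Suc by simp
    moreover have "q * P n = smult c (P (Suc d) * P n) + r * P n"
      by (simp add: r_def algebra_simps)
    ultimately have "L (q * P n) = c * L (P (Suc d) * P n)"
      by (simp add: L_add L_smult)
    then show ?case using Suc.prems orth_P[of "Suc d" n]
      by (cases "Suc d = n") (auto simp: c_def h_def coeff_eq_0)
  qed
  then show ?thesis using assms by blast
qed

lemma X_mult_P: "monom 1 1 * P (Suc n) = P (Suc (Suc n)) + smult (\<beta> (Suc n)) (P n)"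
  using recurrence[unfolded recurrence_coeffs_def, rule_format, of "Suc n"]
  by (simp add: monom_altdef)

text \<open>Pairing with \<open>P (n + r)\<close> extracts its coefficient in x^(r+e)
  \<open>P (n + e)\<close>. By the recurrence each factor x acts as an up-step or a down-step, so
  this coefficient is a sum over paths; the induction splits off the first step.\<close>

lemma L_path_weight: "L (monom 1 (r + e) * P (n + e) * P (n + r)) = path_weight \<beta> r e n * h (n + r)"
proof (induction r e n rule: path_weight.induct)
  case (1 r n)
  have "degree (monom 1 r * P n) \<le> n + r"
    by (rule order.trans[OF degree_mult_le]) (simp add: degree_P degree_monom_eq)
  then show ?case by (simp add: L_mult_P_of_degree_le coeff_monom_mult)
next
  case (2 e n)
  have split: "monom 1 (Suc e) * P (n + Suc e) * P n = monom 1 e * P n * P (Suc (Suc (n + e)))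
      + smult (\<beta> (n + e + 1)) (monom 1 e * P (n + e) * P n)"
    using arg_cong[OF X_mult_P[of "n + e"], of "\<lambda>p. monom 1 e * p * P n"]
    by (simp add: algebra_simps monom_mult_X mult_smult_right)
  \<comment> \<open>An up-step is excluded here: with \<open>e\<close> factors x left, height n + e
    + 2 cannot come down to n.\<close>
  have "degree (monom 1 e * P n) < Suc (Suc (n + e))"
    by (rule le_less_trans[OF degree_mult_le]) (simp add: degree_P degree_monom_eq)
  then have "L (monom 1 e * P n * P (Suc (Suc (n + e)))) = 0"
    by (simp add: L_mult_P_of_degree_le coeff_eq_0 less_imp_le)
  then show ?case using 2 split by (simp add: L_add L_smult)
next
  case (3 r e n)
  have "monom 1 (Suc r + Suc e) * P (n + Suc e) * P (n + Suc r)
      = monom 1 (r + Suc e) * P (n + 1 + Suc e) * P (n + 1 + r)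
      + smult (\<beta> (n + e + 1)) (monom 1 (Suc r + e) * P (n + e) * P (n + Suc r))"
    using arg_cong[OF X_mult_P[of "n + e"], of "\<lambda>p. monom 1 (Suc (r + e)) * p * P (Suc (n + r))"]
    by (simp add: algebra_simps monom_mult_X mult_smult_right)
  then show ?case using 3 by (simp add: L_add L_smult algebra_simps)
qed

text \<open>Integrate by parts with q = \<open>P (Suc n) * P n\<close>. The derivative of
  \<open>P n\<close> is orthogonal to \<open>P (Suc n)\<close> by degree, and the derivative of
  \<open>P (Suc n)\<close> has leading coefficient n + 1.\<close>

lemma L_pderiv_V: "L (pderiv V * P (Suc n) * P n) = real (Suc n) * h n"
proof -
  have "L (pderiv V * P (Suc n) * P n) = L (P (Suc n) * pderiv (P n) + P n * pderiv (P (Suc n)))"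
    using L_pderiv[of "P (Suc n) * P n"] by (simp add: pderiv_mult mult.assoc)
  also have "\<dots> = L (pderiv (P n) * P (Suc n)) + L (pderiv (P (Suc n)) * P n)"
    by (simp add: L_add mult.commute)
  also have "L (pderiv (P n) * P (Suc n)) = 0"
    by (subst L_mult_P_of_degree_le) (auto simp: degree_pderiv degree_P coeff_pderiv coeff_eq_0)
  also have "L (pderiv (P (Suc n)) * P n) = real (Suc n) * h n"
    by (subst L_mult_P_of_degree_le) (auto simp: degree_pderiv degree_P coeff_pderiv)
  finally show ?thesis by simp
qed

text \<open>Expanding V' in \<open>L_pderiv_V\<close> turns x^(2k-1) into paths with
  \<open>k - 1\<close> up-steps and \<open>k\<close> down-steps. The index is n + m rather than n,
  so that every base height n + (m - k) is an untruncated difference.\<close>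

lemma string_equation:
  assumes "m \<ge> 1" and V: "V = (\<Sum>k=1..m. monom (t k) (2 * k))"
  shows "(\<Sum>k=1..m. 2 * real k * t k * path_weight \<beta> (k - 1) k (n + (m - k))) = real (n + m)"
proof -
  from \<open>m \<ge> 1\<close> obtain m' where m': "m = Suc m'" by (cases m) auto
  define N where "N = n + m'"
  have "real (Suc N) * h N = L (pderiv V * P (Suc N) * P N)" by (simp add: L_pderiv_V)
  also have "pderiv V = (\<Sum>k=1..m. smult (2 * real k * t k) (monom 1 (2 * k - 1)))"
    by (simp add: V higher_pderiv_sum[where n = 1, simplified] pderiv_monom smult_monom mult_ac)
  also have "L (\<dots> * P (Suc N) * P N) = (\<Sum>k=1..m. 2 * real k * t k * L (monom 1 (2 * k - 1) * P (Suc N) * P N))"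
    by (simp add: sum_distrib_right L_sum L_smult)
  also have "\<dots> = (\<Sum>k=1..m. 2 * real k * t k * path_weight \<beta> (k - 1) k (n + (m - k)) * h N)"
  proof (intro sum.cong refl)
    fix k assume k: "k \<in> {1..m}"
    \<comment> \<open>The base height depends on \<open>k\<close> in such a way that all paths lead
      from \<open>Suc N\<close> to \<open>N\<close>.\<close>
    then have "k - 1 + k = 2 * k - 1" "n + (m - k) + k = Suc N" "n + (m - k) + (k - 1) = N"
      by (auto simp: N_def m')
    then show "2 * real k * t k * L (monom 1 (2 * k - 1) * P (Suc N) * P N)
        = 2 * real k * t k * path_weight \<beta> (k - 1) k (n + (m - k)) * h N"
      using L_path_weight[of "k - 1" k "n + (m - k)"] by simp
  qed
  finally have "(\<Sum>k=1..m. 2 * real k * t k * path_weight \<beta> (k - 1) k (n + (m - k))) * h N = real (n + m) * h N"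
    unfolding sum_distrib_right by (simp add: N_def m' del: sum.cl_ivl_Suc)
  then show ?thesis using h_pos[of N] by simp
qed

end

subsection \<open>Convergence at rate 1/n\<close>

text \<open>As a predicate, c + O(1/n) passes through sums, products and inverses by introduction
  rules, without explicit error terms.\<close>

definition near :: "(nat \<Rightarrow> real) \<Rightarrow> real \<Rightarrow> bool" where
  "near f c \<longleftrightarrow> (\<lambda>n. f n - c) \<in> O(\<lambda>n. 1 / real n)"

lemma near_const [simp]: "near (\<lambda>_. c) c"
  by (simp add: near_def)

lemma near_add: "near f c \<Longrightarrow> near g d \<Longrightarrow> near (\<lambda>n. f n + g n) (c + d)"
  unfolding near_def by (drule (1) sum_in_bigo) (simp add: algebra_simps)

lemma near_sum: "(\<And>i. i \<in> I \<Longrightarrow> near (f i) (c i)) \<Longrightarrow> near (\<lambda>n. \<Sum>i\<in>I. f i n) (\<Sum>i\<in>I. c i)"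
  by (induction I rule: infinite_finite_induct) (auto intro: near_add)

lemma near_tendsto: "near f c \<Longrightarrow> f \<longlonglongrightarrow> c"
proof -
  assume "near f c"
  moreover have "(\<lambda>n. 1 / real n) \<in> o(\<lambda>_. 1)" by real_asymp
  ultimately have "(\<lambda>n. f n - c) \<in> o(\<lambda>_. 1)"
    unfolding near_def by (rule landau_o.big_small_trans)
  then show ?thesis using smalloD_tendsto[of "\<lambda>n. f n - c"] LIM_zero_iff by force
qed

text \<open>f g - c d = (f - c) g + c (g - d), where g is bounded because it converges.\<close>

lemma near_mult:
  assumes "near f c" "near g d"
  shows "near (\<lambda>n. f n * g n) (c * d)"
proof -
  have "g \<in> O(\<lambda>_. 1)"
    using near_tendsto[OF assms(2)] by (intro bigoI_tendsto[where c = d]) auto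
  then have "(\<lambda>n. (f n - c) * g n) \<in> O(\<lambda>n. 1 / real n * 1)"
    using assms(1) unfolding near_def by (intro landau_o.big.mult)
  moreover have "(\<lambda>n. c * (g n - d)) \<in> O(\<lambda>n. 1 / real n)"
    using assms(2) unfolding near_def by simp
  ultimately have "(\<lambda>n. (f n - c) * g n + c * (g n - d)) \<in> O(\<lambda>n. 1 / real n)"
    by (intro sum_in_bigo) simp_all
  then show ?thesis by (simp add: near_def algebra_simps)
qed

lemma near_inverse:
  assumes "near f c" "c \<noteq> 0"
  shows "near (\<lambda>n. inverse (f n)) (inverse c)"
proof -
  have lim: "f \<longlonglongrightarrow> c" using assms(1) by (rule near_tendsto)
  have "(\<lambda>n. - inverse (f n) * inverse c) \<in> O(\<lambda>_. 1)"
    using lim \<open>c \<noteq> 0\<close> by (intro bigoI_tendsto[where c = "- inverse c * inverse c"]) (auto intro!: tendsto_eq_intros)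
  then have "(\<lambda>n. (f n - c) * (- inverse (f n) * inverse c)) \<in> O(\<lambda>n. 1 / real n * 1)"
    using assms(1) unfolding near_def by (intro landau_o.big.mult)
  moreover have "\<forall>\<^sub>F n in sequentially. f n \<noteq> 0"
    using lim \<open>c \<noteq> 0\<close> by (rule tendsto_imp_eventually_ne)
  then have "\<forall>\<^sub>F n in sequentially. (f n - c) * (- inverse (f n) * inverse c) = inverse (f n) - inverse c"
    by eventually_elim (use \<open>c \<noteq> 0\<close> in \<open>simp add: field_simps\<close>)
  ultimately show ?thesis
    unfolding near_def by (subst (asm) landau_o.big.in_cong) simp_all
qed

lemma near_cong: "\<forall>\<^sub>F n in sequentially. f n = g n \<Longrightarrow> near f c \<Longrightarrow> near g c"
  unfolding near_def
  by (erule landau_o.big.in_cong[THEN iffD1, rotated]) (auto elim: eventually_mono)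

lemma near_shift:
  assumes "near f c"
  shows "near (\<lambda>n. f (n + s)) c"
proof -
  have "(\<lambda>n. f (n + s) - c) \<in> O(\<lambda>n. 1 / real (n + s))"
    using landau_o.big.compose[OF assms[unfolded near_def] filterlim_add_const_nat_at_top[of s]] by simp
  also have "(\<lambda>n. 1 / real (n + s)) \<in> O(\<lambda>n. 1 / real n)" by real_asymp
  finally show ?thesis by (simp add: near_def)
qed

text \<open>There are (r+e choose e) paths, each weighted by \<open>e\<close> values of \<beta> at
  bounded distance from n. The offset \<open>s\<close> varies in the induction because an up-step
  raises the base height.\<close>

lemma near_path_weight:
  assumes ratio: "\<And>s. near (\<lambda>n. \<beta> (n + s) / \<beta> n) 1"
  shows "near (\<lambda>n. path_weight \<beta> r e (n + s) / \<beta> n ^ e) (real ((r + e) choose e))"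
proof (induction r e s rule: path_weight.induct)
  case (1 r s)
  then show ?case by simp
next
  case (2 e s)
  have "near (\<lambda>n. \<beta> (n + (s + e + 1)) / \<beta> n * (path_weight \<beta> 0 e (n + s) / \<beta> n ^ e)) (1 * real ((0 + e) choose e))"
    by (intro near_mult ratio 2)
  then show ?case by (simp add: add.assoc)
next
  case (3 r e s)
  \<comment> \<open>The counts for the two possible first steps add up by Pascal's rule.\<close>
  have "near (\<lambda>n. path_weight \<beta> r (Suc e) (n + (s + 1)) / \<beta> n ^ Suc e
      + \<beta> (n + (s + e + 1)) / \<beta> n * (path_weight \<beta> (Suc r) e (n + s) / \<beta> n ^ e))
      (real ((r + Suc e) choose Suc e) + 1 * real ((Suc r + e) choose e))"
    by (intro near_add near_mult ratio 3)
  then show ?case by (simp add: add.assoc add_divide_distrib add_ac)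
qed

text \<open>The Gamma quotient is a binomial coefficient in disguise: by the functional equation of
  Gamma, both sides gain the factor 2(2j+3)/(j+1) from k = j+1 to k = j+2. This matches the string
  equation with the equation for \<open>u\<close>.\<close>

lemma A_altdef:
  assumes "k \<ge> 1"
  shows "A t k * 4 ^ k = 2 * real k * t k * real ((2 * k - 1) choose k)"
proof -
  from assms obtain j where k: "k = Suc j" by (cases k) auto
  have "Gamma (real (Suc j) + 1/2) / (Gamma (1/2) * Gamma (real (Suc j))) * 4 ^ Suc j
      = 2 * real (Suc j) * real ((2 * Suc j - 1) choose Suc j)"
  proof (induction j)
    case 0
    have "Gamma (1/2 + 1 :: real) = 1/2 * Gamma (1/2)" by (rule Gamma_plus1) auto
    then show ?case by (simp add: add.commute field_simps Gamma_one_half_real)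
  next
    case (Suc j)
    have g1: "Gamma (real (Suc (Suc j)) + 1/2) = (real (Suc j) + 1/2) * Gamma (real (Suc j) + 1/2)"
    proof -
      have "real (Suc j) + 1/2 \<notin> \<int>\<^sub>\<le>\<^sub>0"
        using nonpos_Ints_nonpos[of "real (Suc j) + 1/2"] by auto
      from Gamma_plus1[OF this] show ?thesis by (simp add: add_ac)
    qed
    have g2: "Gamma (real (Suc (Suc j))) = real (Suc j) * Gamma (real (Suc j))"
    proof -
      have "real (Suc j) \<notin> \<int>\<^sub>\<le>\<^sub>0" using nonpos_Ints_nonpos[of "real (Suc j)"] by auto
      from Gamma_plus1[OF this] show ?thesis by (simp add: add_ac)
    qed
    \<comment> \<open>Absorption, followed by splitting the central binomial coefficient into two
      equal halves.\<close>
    have b: "real (Suc (Suc j)) * real ((2 * Suc (Suc j) - 1) choose Suc (Suc j))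
        = 2 * (2 * real j + 3) * real ((2 * Suc j - 1) choose Suc j)"
    proof -
      have "Suc (Suc j) * (Suc (2 * j + 2) choose Suc (Suc j)) = Suc (2 * j + 2) * ((2 * j + 2) choose Suc j)"
        by (rule Suc_times_binomial)
      moreover have "(2 * j + 2) choose Suc j = 2 * ((2 * j + 1) choose Suc j)"
        using binomial_symmetric[of j "2 * j + 1"] by simp
      moreover have "Suc (2 * j + 2) = 2 * j + 3" "2 * Suc (Suc j) - 1 = 2 * j + 3" "2 * Suc j - 1 = 2 * j + 1"
        by simp_all
      ultimately have "Suc (Suc j) * ((2 * Suc (Suc j) - 1) choose Suc (Suc j))
          = 2 * (2 * j + 3) * ((2 * Suc j - 1) choose Suc j)"
        by (simp only: mult_ac)
      then have "real (Suc (Suc j) * ((2 * Suc (Suc j) - 1) choose Suc (Suc j)))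
          = real (2 * (2 * j + 3) * ((2 * Suc j - 1) choose Suc j))" by (rule arg_cong)
      then show ?thesis by (simp only: of_nat_mult of_nat_add of_nat_numeral)
    qed
    have "Gamma (real (Suc (Suc j)) + 1/2) / (Gamma (1/2) * Gamma (real (Suc (Suc j)))) * 4 ^ Suc (Suc j)
        = 4 * ((real (Suc j) + 1/2) / real (Suc j))
          * (Gamma (real (Suc j) + 1/2) / (Gamma (1/2) * Gamma (real (Suc j))) * 4 ^ Suc j)"
      unfolding g1 g2 by (simp add: field_simps del: of_nat_Suc)
    also have "\<dots> = 2 * (2 * (2 * real j + 3) * real ((2 * Suc j - 1) choose Suc j))"
      unfolding Suc by (simp add: field_simps)
    also have "\<dots> = 2 * real (Suc (Suc j)) * real ((2 * Suc (Suc j) - 1) choose Suc (Suc j))"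
      unfolding b[symmetric] by simp
    finally show ?case .
  qed
  moreover have "A t (Suc j) * 4 ^ Suc j
      = t (Suc j) * (Gamma (real (Suc j) + 1/2) / (Gamma (1/2) * Gamma (real (Suc j))) * 4 ^ Suc j)"
    by (simp only: A_def times_divide_eq_right times_divide_eq_left mult.assoc)
  ultimately show ?thesis by (simp only: k mult_ac)
qed

subsection \<open>Stability of the positive root\<close>

text \<open>With half of the leading term taken away, the remaining polynomial \<open>Q\<close>
  still has a positive leading coefficient, so it is nondecreasing beyond some \<open>U\<close>. The
  half taken away supplies \<open>c = B m / 2\<close>.\<close>

lemma poly_sub_monom_mono:
  fixes B :: "nat \<Rightarrow> real"
  assumes "m \<ge> 1" "B m > 0"
  obtains c U where "c > 0" "U \<ge> 0"
    "\<And>x y. U \<le> x \<Longrightarrow> x \<le> y \<Longrightarrow>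
      c * (y ^ m - x ^ m) \<le> (\<Sum>k=1..m. B k * y ^ k) - (\<Sum>k=1..m. B k * x ^ k)"
proof -
  define Q where "Q = (\<Sum>k=1..m. monom (B k) k) - monom (B m / 2) m"
  have Q_poly: "poly Q x = (\<Sum>k=1..m. B k * x ^ k) - B m / 2 * x ^ m" for x
    by (simp add: Q_def poly_sum poly_monom)
  have "degree Q \<le> m"
    unfolding Q_def
    by (intro degree_diff_le degree_sum_le degree_monom_le order.trans[OF degree_monom_le]) auto
  have "coeff Q m = B m / 2"
    using assms(1) by (simp add: Q_def coeff_sum coeff_monom if_distrib sum.delta)
  then have coeff: "coeff (pderiv Q) (m - 1) > 0"
    using assms by (simp add: coeff_pderiv)
  moreover have "degree (pderiv Q) = m - 1"
    using le_degree[of "pderiv Q" "m - 1"] coeff \<open>degree Q \<le> m\<close> by (simp add: degree_pderiv)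
  ultimately have "lead_coeff (pderiv Q) > 0" by simp
  then obtain U where U: "\<And>x. x \<ge> U \<Longrightarrow> poly (pderiv Q) x \<ge> 0"
    using poly_pinfty_gt_lc[of "pderiv Q"] by force
  show ?thesis
  proof (rule that[of "B m / 2" "max U 0"])
    fix x y :: real
    assume xy: "max U 0 \<le> x" "x \<le> y"
    have "poly Q x \<le> poly Q y"
    proof (rule DERIV_nonneg_imp_nondecreasing[OF xy(2)])
      fix z assume "x \<le> z" "z \<le> y"
      then show "\<exists>d. (poly Q has_real_derivative d) (at z) \<and> 0 \<le> d"
        using U[of z] xy by (intro exI[of _ "poly (pderiv Q) z"] conjI poly_DERIV) auto
    qed
    then show "B m / 2 * (y ^ m - x ^ m) \<le> (\<Sum>k=1..m. B k * y ^ k) - (\<Sum>k=1..m. B k * x ^ k)"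
      by (simp add: Q_poly algebra_simps)
  qed (use assms in auto)
qed

text \<open>Beyond \<open>U\<close> the polynomial is strictly increasing and unbounded, which gives
  one root there. On [0, U] it is bounded, so for large n no positive root lies in that
  interval.\<close>

lemma eventually_unique_positive_root:
  fixes B :: "nat \<Rightarrow> real"
  assumes "m \<ge> 1" "B m > 0"
  obtains c U where "c > 0"
    "\<And>x y. U \<le> x \<Longrightarrow> U \<le> y \<Longrightarrow>
      c * \<bar>y ^ m - x ^ m\<bar> \<le> \<bar>(\<Sum>k=1..m. B k * y ^ k) - (\<Sum>k=1..m. B k * x ^ k)\<bar>"
    "\<forall>\<^sub>F n in sequentially. \<exists>!u. u > 0 \<and> (\<Sum>k=1..m. B k * u ^ k) = real n"
    "\<forall>\<^sub>F n in sequentially. \<forall>u>0. (\<Sum>k=1..m. B k * u ^ k) = real n \<longrightarrow> u \<ge> U"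
proof -
  define f where "f x = (\<Sum>k=1..m. B k * x ^ k)" for x
  obtain c U where c: "c > 0" "U \<ge> 0"
    and le: "\<And>x y. U \<le> x \<Longrightarrow> x \<le> y \<Longrightarrow> c * (y ^ m - x ^ m) \<le> f y - f x"
    using poly_sub_monom_mono[of m B] assms unfolding f_def by blast
  have abs_le: "c * \<bar>y ^ m - x ^ m\<bar> \<le> \<bar>f y - f x\<bar>" if "U \<le> x" "U \<le> y" for x y
    using that
  proof (induction x y rule: linorder_wlog)
    case (le x y)
    then have "x ^ m \<le> y ^ m" using c by (intro power_mono) auto
    then show ?case using assms(1) \<open>\<And>x y. U \<le> x \<Longrightarrow> x \<le> y \<Longrightarrow> c * (y ^ m - x ^ m) \<le> f y - f x\<close>[of x y] le by simp
  qed (simp add: abs_minus_commute)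
  have cont: "continuous_on S f" for S
    unfolding f_def by (intro continuous_intros)
  have "compact (f ` {0..U})"
    by (intro compact_continuous_image cont compact_Icc)
  then obtain M where M: "\<And>x. x \<in> {0..U} \<Longrightarrow> f x \<le> M"
    using compact_imp_bounded bounded_imp_bdd_above unfolding bdd_above_def by (metis imageI)
  have gt_U: "u > U" if "u > 0" "f u = real n" "real n > M" for u n
    using that M[of u] by force
  have unique: "\<exists>!u. u > 0 \<and> f u = real n" if n: "real n > M" for n
  proof -
    have "filterlim (\<lambda>y. f U + c * (y ^ m - U ^ m)) at_top at_top"
      using \<open>c > 0\<close> \<open>m \<ge> 1\<close> by real_asymp
    then have "\<forall>\<^sub>F y in at_top. f U + c * (y ^ m - U ^ m) \<ge> real n \<and> y \<ge> U"
      by (intro eventually_conj eventually_ge_at_top) (simp add: filterlim_at_top)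
    then obtain y where "f U + c * (y ^ m - U ^ m) \<ge> real n" "y \<ge> U"
      by (auto dest: eventually_happens)
    then have y: "f y \<ge> real n" "y \<ge> U" using le[of U y] by auto
    have "f U \<le> real n" using M[of U] c n by simp
    then obtain u where u: "u \<ge> U" "f u = real n"
      using IVT'[of f U "real n" y] y cont by auto
    have "u \<noteq> 0" using u M[of 0] n c by auto
    show ?thesis
    proof (rule ex1I[of _ u])
      show "u > 0 \<and> f u = real n" using u c \<open>u \<noteq> 0\<close> by auto
      fix v assume v: "v > 0 \<and> f v = real n"
      then have "c * \<bar>v ^ m - u ^ m\<bar> \<le> 0"
        using abs_le[of u v] gt_U[of v n] u n by simp
      then have "v ^ m = u ^ m" using c by (simp add: mult_le_0_iff)
      then show "v = u" using \<open>m \<ge> 1\<close> v u c by (simp add: power_eq_iff_eq_base)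
    qed
  qed
  have ev: "\<forall>\<^sub>F n in sequentially. real n > M"
    using filterlim_real_sequentially by (simp add: filterlim_at_top_dense)
  show ?thesis
  proof (rule that[OF c(1) abs_le[unfolded f_def]])
    show "\<forall>\<^sub>F n in sequentially. \<exists>!u. u > 0 \<and> (\<Sum>k=1..m. B k * u ^ k) = real n"
      using ev by eventually_elim (use unique in \<open>simp add: f_def\<close>)
    show "\<forall>\<^sub>F n in sequentially. \<forall>u>0. (\<Sum>k=1..m. B k * u ^ k) = real n \<longrightarrow> u \<ge> U"
      using ev by eventually_elim (use gt_U in \<open>force simp: f_def\<close>)
  qed
qed

text \<open>Lets a bound on (u/v)^m - 1 pass to u/v - 1 without extracting roots.\<close>

lemma abs_diff_one_le_power:
  fixes r :: real
  assumes "r \<ge> 0" "m \<ge> 1"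
  shows "\<bar>r - 1\<bar> \<le> \<bar>r ^ m - 1\<bar>"
proof (cases "r \<ge> 1")
  case True
  then show ?thesis using power_increasing[of 1 m r] assms by simp
next
  case False
  then show ?thesis using power_decreasing[of 1 m r] assms by simp
qed

text \<open>A residual bounded by \<open>K\<close> gives |u^m - v^m| \<le> K/c by the monotonicity
  estimate. Division by v^m, which is at least of order n, leaves an O(1/n) error for (u/v)^m and
  hence for u/v.\<close>

lemma near_root:
  fixes B :: "nat \<Rightarrow> real"
  assumes "m \<ge> 1" "B m > 0"
    and residual: "(\<lambda>n. (\<Sum>k=1..m. B k * v n ^ k) - real n) \<in> O(\<lambda>_. 1)"
    and v_top: "filterlim v at_top sequentially"
    and v_power: "(\<lambda>n. real n) \<in> O(\<lambda>n. v n ^ m)"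
  shows "near (\<lambda>n. v n / (THE u. u > 0 \<and> (\<Sum>k=1..m. B k * u ^ k) = real n)) 1"
proof -
  define f where "f x = (\<Sum>k=1..m. B k * x ^ k)" for x
  define u where "u n = (THE u. u > 0 \<and> f u = real n)" for n :: nat
  obtain c U where c: "c > 0"
    and le: "\<And>x y. U \<le> x \<Longrightarrow> U \<le> y \<Longrightarrow> c * \<bar>y ^ m - x ^ m\<bar> \<le> \<bar>f y - f x\<bar>"
    and ex1: "\<forall>\<^sub>F n in sequentially. \<exists>!u. u > 0 \<and> f u = real n"
    and ge: "\<forall>\<^sub>F n in sequentially. \<forall>u>0. f u = real n \<longrightarrow> u \<ge> U"
    using eventually_unique_positive_root[of m B] assms(1,2) unfolding f_def by blast
  obtain K where K: "\<forall>\<^sub>F n in sequentially. \<bar>f (v n) - real n\<bar> \<le> K"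
    using residual unfolding f_def by (elim landau_o.bigE) auto
  have "(\<lambda>n. u n / v n - 1) \<in> O(\<lambda>n. 1 / v n ^ m)"
  proof (rule bigoI[of _ "K / c"])
    have "\<forall>\<^sub>F n in sequentially. v n \<ge> max U 1"
      using v_top unfolding filterlim_at_top by blast
    then show "\<forall>\<^sub>F n in sequentially. norm (u n / v n - 1) \<le> K / c * norm (1 / v n ^ m)"
      using K ge ex1
    proof eventually_elim
      case (elim n)
      have u: "u n > 0" "f (u n) = real n"
        using theI'[OF elim(4)] by (auto simp: u_def)
      have "\<bar>u n / v n - 1\<bar> \<le> \<bar>(u n / v n) ^ m - 1\<bar>"
        using elim(1) u \<open>m \<ge> 1\<close> by (intro abs_diff_one_le_power) auto
      also have "(u n / v n) ^ m - 1 = (u n ^ m - v n ^ m) / v n ^ m"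
        using elim(1) by (simp add: power_divide diff_divide_distrib)
      also have "\<bar>\<dots>\<bar> = \<bar>u n ^ m - v n ^ m\<bar> / v n ^ m"
        using elim(1) by (simp add: abs_divide)
      also have "\<bar>u n ^ m - v n ^ m\<bar> \<le> K / c"
      proof -
        have "c * \<bar>u n ^ m - v n ^ m\<bar> \<le> \<bar>f (u n) - f (v n)\<bar>"
          using elim(1,3) u by (intro le) auto
        also have "\<dots> \<le> K" using elim(2) u by (simp add: abs_minus_commute)
        finally show ?thesis using c by (simp add: field_simps)
      qed
      finally show ?case using elim(1) by (simp add: divide_right_mono)
    qed
  qed
  also have "(\<lambda>n. 1 / v n ^ m) \<in> O(\<lambda>n. 1 / real n)"
  proof -
    have "\<forall>\<^sub>F n in sequentially. v n > 0"
      using v_top by (simp add: filterlim_at_top_dense)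
    then have "\<forall>\<^sub>F n in sequentially. v n ^ m \<noteq> 0" by eventually_elim simp
    moreover have "\<forall>\<^sub>F n in sequentially. real n \<noteq> 0"
      using eventually_gt_at_top[of 0] by eventually_elim simp
    ultimately show ?thesis
      using v_power landau_o.big.inverse[of "\<lambda>n. real n" sequentially "\<lambda>n. v n ^ m"]
      by (simp add: divide_inverse)
  qed
  finally have "near (\<lambda>n. u n / v n) 1" by (simp add: near_def)
  \<comment> \<open>The estimate was made for u/v because the growth of \<open>v\<close>, not of
    \<open>u\<close>, is given.\<close>
  from near_inverse[OF this] have "near (\<lambda>n. v n / u n) 1" by simp
  then show ?thesis by (simp add: u_def f_def)
qed

subsection \<open>Consequences of the expansion\<close>

lemma near_powr_ratio: "near (\<lambda>n. real (n + s) powr p / real n powr p) 1"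
  unfolding near_def by real_asymp

lemma near_powr_diff:
  assumes "p \<le> 0"
  shows "near (\<lambda>n. real (n + s) powr p - real n powr p) 0"
proof -
  have "(\<lambda>n. real n powr p * (real (n + s) powr p / real n powr p - 1)) \<in> O(\<lambda>n. 1 * (1 / real n))"
  proof (rule landau_o.big.mult)
    show "(\<lambda>n. real n powr p) \<in> O(\<lambda>_. 1)"
    proof (rule bigoI[of _ 1])
      show "\<forall>\<^sub>F n in sequentially. norm (real n powr p) \<le> 1 * norm (1 :: real)"
        using eventually_ge_at_top[of 1]
        by eventually_elim (use assms powr_mono[of p 0] in auto)
    qed
  qed (use near_powr_ratio in \<open>simp add: near_def\<close>)
  moreover have "\<forall>\<^sub>F n in sequentially. real n powr p * (real (n + s) powr p / real n powr p - 1)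
      = real (n + s) powr p - real n powr p - 0"
    using eventually_gt_at_top[of 0] by eventually_elim (simp add: field_simps)
  ultimately show ?thesis unfolding near_def by (subst (asm) landau_o.big.in_cong) simp_all
qed

lemma powr_root_at_top:
  assumes "c > 0" "p > 0"
  shows "filterlim (\<lambda>n. (real n / c) powr p) at_top sequentially"
  using assms by real_asymp

lemma near_ratio_of_slow:
  assumes lim: "g \<longlonglongrightarrow> 1" and diff: "near (\<lambda>n. g (n + s) - g n) 0"
  shows "near (\<lambda>n. g (n + s) / g n) (1 :: real)"
proof -
  have "(\<lambda>n. inverse (g n)) \<in> O(\<lambda>_. 1)"
    using lim by (intro bigoI_tendsto[where c = 1]) (auto intro!: tendsto_eq_intros)
  then have "(\<lambda>n. (g (n + s) - g n - 0) * inverse (g n)) \<in> O(\<lambda>n. 1 / real n * 1)"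
    using diff unfolding near_def by (intro landau_o.big.mult)
  moreover have "\<forall>\<^sub>F n in sequentially. g n \<noteq> 0"
    using lim by (rule tendsto_imp_eventually_ne) simp
  then have "\<forall>\<^sub>F n in sequentially. (g (n + s) - g n - 0) * inverse (g n) = g (n + s) / g n - 1"
    by eventually_elim (simp add: field_simps)
  ultimately show ?thesis
    unfolding near_def by (subst (asm) landau_o.big.in_cong) simp_all
qed

text \<open>Collects what follows from the expansion. Orthogonality enters its lemmas only through
  explicit assumptions, the string equation or the residual bound.\<close>

locale expansion =
  fixes m :: nat and t \<beta> a :: "nat \<Rightarrow> real"
  assumes m: "m \<ge> 1" and tm: "t m > 0" and expansion: "has_expansion m t \<beta> a"
begin

text \<open>The leading term of the expansion of \<beta>; four times it is the scale of
  \<open>u\<close>.\<close>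

definition \<kappa> :: "nat \<Rightarrow> real" where
  "\<kappa> n = (real n / (4 ^ m * A t m)) powr (1 / real m)"

lemma A_pos: "A t m > 0"
  using m tm by (simp add: A_def Gamma_real_pos)

lemma \<kappa>_pos: "n > 0 \<Longrightarrow> \<kappa> n > 0"
  using A_pos by (simp add: \<kappa>_def)

lemma \<kappa>_eq: "\<kappa> n = (1 / (4 ^ m * A t m)) powr (1 / real m) * real n powr (1 / real m)"
  using A_pos by (simp add: \<kappa>_def powr_divide powr_mult)

lemma four_\<kappa>: "4 * \<kappa> n = (real n / A t m) powr (1 / real m)"
proof -
  have "(4 ^ m) powr (1 / real m) = (4 :: real)"
    using m by (simp add: powr_powr flip: powr_realpow)
  then show ?thesis
    using A_pos by (simp add: \<kappa>_def powr_divide powr_mult)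
qed

lemma four_\<kappa>_power: "(4 * \<kappa> n) ^ m = real n / A t m"
  using m A_pos unfolding four_\<kappa>
  by (cases "n = 0") (auto simp: powr_powr simp flip: powr_realpow)

text \<open>Truncation at \<open>N = m - 1\<close> leaves an error of order n^(-m/m) = 1/n.\<close>

lemma near_remainder:
  "near (\<lambda>n. \<beta> n / \<kappa> n - (\<Sum>i=1..m-1. a i * real n powr (- real i / real m))) 1"
proof -
  have "(\<lambda>n. \<beta> n / \<kappa> n - (1 + (\<Sum>i=1..m-1. a i * real n powr (- real i / real m))))
      \<in> O(\<lambda>n. real n powr (- 1))"
    using expansion[unfolded has_expansion_def, rule_format, of "m - 1"] m
    by (simp add: \<kappa>_def)
  also have "(\<lambda>n. real n powr (- 1)) \<in> O(\<lambda>n. 1 / real n)" by real_asymp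
  finally show ?thesis by (simp add: near_def algebra_simps)
qed

lemma ratio_\<kappa>_tendsto: "(\<lambda>n. \<beta> n / \<kappa> n) \<longlonglongrightarrow> 1"
proof -
  have "(\<lambda>n. real n powr (- real i / real m)) \<longlonglongrightarrow> 0" if "i \<ge> 1" for i
    using that m by (intro tendsto_neg_powr filterlim_real_sequentially) simp
  then have "(\<lambda>n. \<beta> n / \<kappa> n - (\<Sum>i=1..m-1. a i * real n powr (- real i / real m))
      + (\<Sum>i=1..m-1. a i * real n powr (- real i / real m))) \<longlonglongrightarrow> 1 + (\<Sum>i=1..m-1. a i * 0)"
    by (intro tendsto_intros near_tendsto[OF near_remainder]) auto
  then show ?thesis by simp
qed

text \<open>A shift of n changes each power n^(-i/m) by O(1/n) and \<kappa> by a factor 1 +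
  O(1/n).\<close>

lemma near_shift_ratio: "near (\<lambda>n. \<beta> (n + s) / \<beta> n) 1"
proof -
  let ?F = "\<lambda>n. \<Sum>i=1..m-1. a i * real n powr (- real i / real m)"
  let ?g = "\<lambda>n. \<beta> n / \<kappa> n"
  \<comment> \<open>The limit of \<open>?g\<close> alone does not supply the rate 1/n, so the powers
    in \<open>?F\<close> are split off and compared one by one.\<close>
  have "near (\<lambda>n. ((?g (n + s) - ?F (n + s)) + (-1) * (?g n - ?F n))
      + (\<Sum>i=1..m-1. a i * (real (n + s) powr (- real i / real m) - real n powr (- real i / real m))))
      ((1 + (-1) * 1) + (\<Sum>i=1..m-1. a i * 0))"
    by (intro near_add near_mult near_sum near_const near_powr_diff near_remainder
        near_shift[OF near_remainder]) auto
  then have "near (\<lambda>n. ?g (n + s) - ?g n) 0"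
    by (simp add: sum_subtractf right_diff_distrib)
  then have "near (\<lambda>n. ?g (n + s) / ?g n * (real (n + s) powr (1 / real m) / real n powr (1 / real m))) (1 * 1)"
    by (intro near_mult near_ratio_of_slow near_powr_ratio ratio_\<kappa>_tendsto)
  moreover have "\<forall>\<^sub>F n in sequentially.
      ?g (n + s) / ?g n * (real (n + s) powr (1 / real m) / real n powr (1 / real m)) = \<beta> (n + s) / \<beta> n"
    using eventually_gt_at_top[of 0]
  proof eventually_elim
    case (elim n)
    then have "real (n + s) powr (1 / real m) / real n powr (1 / real m) = \<kappa> (n + s) / \<kappa> n"
      using A_pos by (simp add: \<kappa>_eq)
    then show ?case using \<kappa>_pos[of n] \<kappa>_pos[of "n + s"] elim by simp
  qed
  ultimately show ?thesis using near_cong by force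
qed

lemma power_bigo:
  assumes "k \<le> m"
  shows "(\<lambda>n. \<beta> n ^ k) \<in> O(\<lambda>n. real n)"
proof -
  have "(\<lambda>n. \<beta> n / \<kappa> n) \<in> O(\<lambda>_. 1)"
    using ratio_\<kappa>_tendsto by (intro bigoI_tendsto[where c = 1]) auto
  then have "(\<lambda>n. \<beta> n / \<kappa> n * \<kappa> n) \<in> O(\<lambda>n. 1 * \<kappa> n)"
    by (intro landau_o.big.mult) simp_all
  moreover have "\<forall>\<^sub>F n in sequentially. \<beta> n / \<kappa> n * \<kappa> n = \<beta> n"
    using eventually_gt_at_top[of 0] by eventually_elim (simp add: \<kappa>_pos less_imp_neq[symmetric])
  ultimately have "\<beta> \<in> O(\<kappa>)"
    by (subst (asm) landau_o.big.in_cong) simp_all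
  also have "\<kappa> \<in> O(\<lambda>n. real n powr (1 / real m))"
    using A_pos by (simp add: \<kappa>_eq[abs_def])
  finally have "(\<lambda>n. \<beta> n ^ k) \<in> O(\<lambda>n. (real n powr (1 / real m)) ^ k)"
    by (rule landau_o.big_power)
  also have "(\<lambda>n. (real n powr (1 / real m)) ^ k) \<in> O(\<lambda>n. real n)"
  proof (rule bigoI[of _ 1])
    show "\<forall>\<^sub>F n in sequentially. norm ((real n powr (1 / real m)) ^ k) \<le> 1 * norm (real n)"
      using eventually_gt_at_top[of 0]
    proof eventually_elim
      case (elim n)
      then have "(real n powr (1 / real m)) ^ k = real n powr (real k / real m)"
        by (simp add: powr_powr flip: powr_realpow)
      also have "\<dots> \<le> real n powr 1" using elim assms m by (intro powr_mono) auto
      finally show ?case using elim by simp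
    qed
  qed
  finally show ?thesis .
qed

text \<open>Replacing the path weight by its main term (2k-1 choose k) \<beta>^k costs \<beta>^k
  O(1/n), which is O(1) because \<beta>^k = O(n) for k \<le> m. \<open>A_altdef\<close> turns the
  main terms into the polynomial in 4\<beta>.\<close>

lemma residual_bounded:
  assumes string: "\<And>n. (\<Sum>k=1..m. 2 * real k * t k * path_weight \<beta> (k - 1) k (n + (m - k))) = real (n + m)"
  shows "(\<lambda>n. (\<Sum>k=1..m. A t k * (4 * \<beta> n) ^ k) - real n) \<in> O(\<lambda>_. 1)"
proof -
  define d where "d k n = path_weight \<beta> (k - 1) k (n + (m - k)) - real ((k - 1 + k) choose k) * \<beta> n ^ k" for k n
  have nz: "\<forall>\<^sub>F n in sequentially. \<beta> n \<noteq> 0"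
    using tendsto_imp_eventually_ne[OF ratio_\<kappa>_tendsto, of 0] by (auto elim: eventually_mono)
  have d: "(\<lambda>n. d k n) \<in> O(\<lambda>_. 1)" if "k \<in> {1..m}" for k
  proof -
    have "(\<lambda>n. \<beta> n ^ k * (path_weight \<beta> (k - 1) k (n + (m - k)) / \<beta> n ^ k - real ((k - 1 + k) choose k)))
        \<in> O(\<lambda>n. real n * (1 / real n))"
      using that near_path_weight[OF near_shift_ratio, of "k - 1" k "m - k", unfolded near_def]
      by (intro landau_o.big.mult power_bigo) simp_all
    also have "(\<lambda>n. real n * (1 / real n)) \<in> O(\<lambda>_. 1)"
      by (rule bigoI[of _ 1]) auto
    finally show ?thesis
      by (rule landau_o.big.in_cong[THEN iffD1, rotated])
        (use nz in eventually_elim, simp add: d_def right_diff_distrib)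
  qed
  \<comment> \<open>The summand \<open>real m\<close> comes from the index n + m of the string
    equation.\<close>
  have "(\<Sum>k=1..m. A t k * (4 * \<beta> n) ^ k) - real n = real m + (\<Sum>k=1..m. - (2 * real k * t k) * d k n)" for n
  proof -
    have "(\<Sum>k=1..m. A t k * (4 * \<beta> n) ^ k) = (\<Sum>k=1..m. 2 * real k * t k * real ((k - 1 + k) choose k) * \<beta> n ^ k)"
    proof (intro sum.cong refl)
      fix k assume k: "k \<in> {1..m}"
      have "k - 1 + k = 2 * k - 1" using k by auto
      moreover have "A t k * (4 * \<beta> n) ^ k = A t k * 4 ^ k * \<beta> n ^ k"
        by (simp add: power_mult_distrib)
      ultimately show "A t k * (4 * \<beta> n) ^ k = 2 * real k * t k * real ((k - 1 + k) choose k) * \<beta> n ^ k"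
        using A_altdef[of k t] k by simp
    qed
    then show ?thesis
      using string[of n] by (simp add: d_def right_diff_distrib sum_subtractf sum_negf algebra_simps)
  qed
  moreover have "(\<lambda>n. - (2 * real k * t k) * d k n) \<in> O(\<lambda>_. 1)" if "k \<in> {1..m}" for k
    using landau_o.big.mult[OF bigo_const d[OF that]] by simp
  then have "(\<lambda>n. real m + (\<Sum>k=1..m. - (2 * real k * t k) * d k n)) \<in> O(\<lambda>_. 1)"
    by (intro sum_in_bigo(1) big_sum_in_bigo) auto
  ultimately show ?thesis by simp
qed

lemma filterlim_four_mult: "filterlim (\<lambda>n. 4 * \<beta> n) at_top sequentially"
  and bigo_four_mult_power: "(\<lambda>n. real n) \<in> O(\<lambda>n. (4 * \<beta> n) ^ m)"
proof -
  have eq: "\<forall>\<^sub>F n in sequentially. \<beta> n / \<kappa> n * (4 * \<kappa> n) = 4 * \<beta> n"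
    using eventually_gt_at_top[of 0] by eventually_elim (simp add: \<kappa>_pos less_imp_neq[symmetric])
  have "1 / real m > 0" using m by simp
  then have "filterlim (\<lambda>n. 4 * \<kappa> n) at_top sequentially"
    unfolding four_\<kappa> by (rule powr_root_at_top[OF A_pos])
  then have "filterlim (\<lambda>n. \<beta> n / \<kappa> n * (4 * \<kappa> n)) at_top sequentially"
    by (intro filterlim_tendsto_pos_mult_at_top[OF ratio_\<kappa>_tendsto]) auto
  then show "filterlim (\<lambda>n. 4 * \<beta> n) at_top sequentially"
    by (rule filterlim_cong[OF refl refl eq, THEN iffD1])
  \<comment> \<open>Half of the limit 1 serves as lower bound; the resulting \<kappa> < 2\<beta>
    accounts for the factor 2^m below.\<close>
  have ev: "\<forall>\<^sub>F n in sequentially. \<beta> n / \<kappa> n > 1 / 2"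
    using order_tendstoD(1)[OF ratio_\<kappa>_tendsto, of "1/2"] by simp
  show "(\<lambda>n. real n) \<in> O(\<lambda>n. (4 * \<beta> n) ^ m)"
  proof (rule bigoI[of _ "A t m * 2 ^ m"])
    show "\<forall>\<^sub>F n in sequentially. norm (real n) \<le> A t m * 2 ^ m * norm ((4 * \<beta> n) ^ m)"
      using ev eventually_gt_at_top[of 0]
    proof eventually_elim
      case (elim n)
      have "real n = A t m * (4 * \<kappa> n) ^ m" unfolding four_\<kappa>_power using A_pos by simp
      also have "\<dots> \<le> A t m * (2 * (4 * \<beta> n)) ^ m"
        using elim \<kappa>_pos[of n] A_pos by (intro mult_left_mono power_mono) (auto simp: field_simps)
      also have "\<dots> = A t m * 2 ^ m * (4 * \<beta> n) ^ m" by (simp only: power_mult_distrib mult.assoc)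
      also have "\<dots> \<le> A t m * 2 ^ m * norm ((4 * \<beta> n) ^ m)"
        using A_pos by (intro mult_left_mono) auto
      finally show ?case by simp
    qed
  qed
qed
end

subsection \<open>The coefficients of the expansion\<close>

text \<open>The constant coefficient is the limit of p(s), so it must vanish once j > 0. One factor
  s then cancels on both sides, which lowers j by one.\<close>

lemma poly_bigo_power_iff:
  fixes s :: "nat \<Rightarrow> real"
  assumes lim: "s \<longlonglongrightarrow> 0" and nz: "\<forall>\<^sub>F n in sequentially. s n \<noteq> 0"
  shows "(\<lambda>n. poly p (s n)) \<in> O(\<lambda>n. s n ^ j) \<longleftrightarrow> (\<forall>i<j. coeff p i = 0)"
proof (induction j arbitrary: p)
  case 0
  have "(\<lambda>n. poly p (s n)) \<longlonglongrightarrow> poly p 0"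
    by (intro tendsto_intros lim)
  then have "(\<lambda>n. poly p (s n)) \<in> O(\<lambda>_. 1)" by (intro bigoI_tendsto[where c = "poly p 0"]) auto
  then show ?case by simp
next
  case (Suc j)
  obtain c q where p: "p = pCons c q" by (cases p)
  have cancel: "(\<lambda>n. s n * poly q (s n)) \<in> O(\<lambda>n. s n * s n ^ j) \<longleftrightarrow> (\<forall>i<j. coeff q i = 0)"
    using nz by (subst landau_o.big.mult_cancel_left) (auto simp: Suc)
  have "c = 0" if "(\<lambda>n. poly p (s n)) \<in> O(\<lambda>n. s n ^ Suc j)"
  proof -
    have "(\<lambda>n. s n ^ Suc j) \<longlonglongrightarrow> 0 ^ Suc j" by (intro tendsto_intros lim)
    then have "(\<lambda>n. s n ^ Suc j) \<in> o(\<lambda>_. 1)"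
      by (intro smalloI_tendsto) auto
    with that have "(\<lambda>n. poly p (s n)) \<in> o(\<lambda>_. 1)" by (rule landau_o.big_small_trans)
    then have "(\<lambda>n. poly p (s n)) \<longlonglongrightarrow> 0" by (auto dest: smalloD_tendsto)
    moreover have "(\<lambda>n. poly p (s n)) \<longlonglongrightarrow> poly p 0" by (intro tendsto_intros lim)
    ultimately show "c = 0" using LIMSEQ_unique p by fastforce
  qed
  then show ?case using cancel by (auto simp: p less_Suc_eq_0_disj)
qed

text \<open>Telescoping: y^(k+1) - z^(k+1) = y^k (y - z) + z (y^k - z^k) with y and z
  bounded.\<close>

lemma near_power_diff:
  assumes "near (\<lambda>n. y n - z n) 0" "y \<in> O(\<lambda>_. 1)" "z \<in> O(\<lambda>_. 1)"
  shows "(\<lambda>n. y n ^ k - z n ^ k) \<in> O(\<lambda>n. 1 / real n)"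
proof (induction k)
  case (Suc k)
  have "(\<lambda>n. y n ^ k) \<in> O(\<lambda>_. 1)"
    using landau_o.big_power[OF assms(2), of k] by simp
  then have "(\<lambda>n. y n ^ k * (y n - z n) + z n * (y n ^ k - z n ^ k)) \<in> O(\<lambda>n. 1 / real n)"
    using assms Suc landau_o.big.mult[of "\<lambda>n. y n ^ k" _ "\<lambda>_. 1" "\<lambda>n. y n - z n" "\<lambda>n. 1 / real n"]
      landau_o.big.mult[of z _ "\<lambda>_. 1" "\<lambda>n. y n ^ k - z n ^ k" "\<lambda>n. 1 / real n"]
    by (intro sum_in_bigo) (simp_all add: near_def)
  then show ?case by (simp add: algebra_simps)
qed simp

text \<open>Polynomial counterpart of \<open>eq_series\<close> with general coefficients
  \<open>b\<close>; unlike a formal power series, it can be evaluated at n^(-1/m).\<close>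

definition subst_poly :: "(nat \<Rightarrow> real) \<Rightarrow> nat \<Rightarrow> real poly \<Rightarrow> real poly" where
  "subst_poly b m F = (\<Sum>k=1..m. smult (b k) (monom 1 (m - k) * F ^ k))"

text \<open>Binomial expansion to first order: modulo X^(j+1) the power changes by k R(0) X^j, since
  F(0) = 1 and j \<ge> 1 pushes higher terms further up.\<close>

lemma power_perturb:
  fixes F R :: "real poly"
  assumes "coeff F 0 = 1" "j \<ge> 1"
  shows "\<exists>Q. (F + monom 1 j * R) ^ k = F ^ k + monom 1 j * Q \<and> coeff Q 0 = real k * coeff R 0"
proof (induction k)
  case 0
  then show ?case by (intro exI[of _ 0]) simp
next
  case (Suc k)
  then obtain Q where Q: "(F + monom 1 j * R) ^ k = F ^ k + monom 1 j * Q" "coeff Q 0 = real k * coeff R 0"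
    by blast
  have "coeff (F ^ k) 0 = 1" using assms(1) by (simp add: coeff_0_power)
  then have "coeff (R * F ^ k + F * Q + monom 1 j * (R * Q)) 0 = real (Suc k) * coeff R 0"
    using assms Q(2) by (simp add: coeff_mult_0 coeff_monom algebra_simps)
  moreover have "(F + monom 1 j * R) ^ Suc k
      = F ^ Suc k + monom 1 j * (R * F ^ k + F * Q + monom 1 j * (R * Q))"
    unfolding power_Suc Q(1) by (simp add: algebra_simps)
  ultimately show ?case by blast
qed

text \<open>A change of F at order j is first felt at order j, and there only through k = m, as the
  other summands carry a factor X^(m-k). The nonzero factor m makes the recursion solvable.\<close>

lemma coeff_subst_poly_perturb:
  assumes "coeff F 0 = 1" "j \<ge> 1" "m \<ge> 1" "b m = 1"
  shows "i < j \<Longrightarrow> coeff (subst_poly b m (F + monom 1 j * R)) i = coeff (subst_poly b m F) i"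
    and "coeff (subst_poly b m (F + monom 1 j * R)) j = coeff (subst_poly b m F) j + real m * coeff R 0"
proof -
  obtain Q where Q: "\<And>k. (F + monom 1 j * R) ^ k = F ^ k + monom 1 j * Q k"
      "\<And>k. coeff (Q k) 0 = real k * coeff R 0"
    using power_perturb[OF assms(1,2)] by metis
  define T where "T = (\<Sum>k=1..m. smult (b k) (monom 1 (m - k) * Q k))"
  have eq: "subst_poly b m (F + monom 1 j * R) = subst_poly b m F + monom 1 j * T"
    unfolding subst_poly_def T_def Q(1)
    by (simp add: sum_distrib_left smult_add_right sum.distrib distrib_left mult.left_commute)
  have "coeff T 0 = (\<Sum>k=1..m. if k = m then real m * coeff R 0 else 0)"
    unfolding T_def coeff_sum
    by (intro sum.cong refl) (use assms in \<open>auto simp: coeff_mult_0 coeff_monom Q(2)\<close>)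
  then have "coeff T 0 = real m * coeff R 0" using assms(3) by simp
  then show "coeff (subst_poly b m (F + monom 1 j * R)) j = coeff (subst_poly b m F) j + real m * coeff R 0"
    by (simp add: eq coeff_monom_mult)
  show "i < j \<Longrightarrow> coeff (subst_poly b m (F + monom 1 j * R)) i = coeff (subst_poly b m F) i"
    by (simp add: eq coeff_monom_mult)
qed

section \<open>The truncated expansion inside the scaled equation\<close>

context expansion
begin

definition s :: "nat \<Rightarrow> real" where
  "s n = real n powr (- 1 / real m)"

text \<open>Coefficients of the equation after \<open>u\<close> is measured in units of
  (n/A_m)^(1/m); the leading one becomes 1.\<close>

definition b :: "nat \<Rightarrow> real" where
  "b k = A t k * A t m powr (- real k / real m)"

text \<open>The expansion of \<beta>/\<kappa> truncated below order j, as a polynomial in s =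
  n^(-1/m).\<close>

definition G :: "nat \<Rightarrow> real poly" where
  "G j = 1 + (\<Sum>i=1..<j. monom (a i) i)"

lemma b_m: "b m = 1"
  using m A_pos by (simp add: b_def powr_minus_divide)

lemma s_power: "n > 0 \<Longrightarrow> s n ^ k = real n powr (- real k / real m)"
  by (simp add: s_def powr_powr flip: powr_realpow)

lemma s_power_m: "n > 0 \<Longrightarrow> s n ^ m = 1 / real n"
  using m by (simp add: s_power powr_minus_divide)

lemma s_tendsto_0: "s \<longlonglongrightarrow> 0"
  unfolding s_def[abs_def] using m by (intro tendsto_neg_powr filterlim_real_sequentially) simp

lemma s_nonzero: "\<forall>\<^sub>F n in sequentially. s n \<noteq> 0"
  using eventually_gt_at_top[of 0] by eventually_elim (simp add: s_def)

lemma coeff_G_0: "coeff (G j) 0 = 1"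
  by (simp add: G_def coeff_sum coeff_monom)

lemma poly_G: "n > 0 \<Longrightarrow> poly (G j) (s n) = 1 + (\<Sum>i=1..<j. a i * real n powr (- real i / real m))"
  by (simp add: G_def poly_sum poly_monom s_power)

lemma fps_of_poly_subst_poly: "fps_of_poly (subst_poly b m F) = eq_series m t (fps_of_poly F)"
  by (simp add: subst_poly_def eq_series_def b_def fps_of_poly_sum fps_of_poly_smult fps_of_poly_mult
      fps_of_poly_power fps_of_poly_monom' mult.assoc)

lemma fps_of_poly_G: "fps_of_poly (G j) = 1 + (\<Sum>i=1..<j. fps_const (a i) * fps_X ^ i)"
  by (simp add: G_def fps_of_poly_add fps_of_poly_sum fps_of_poly_monom)

lemma sum_scaled:
  assumes "n > 0"
  shows "(\<Sum>k=1..m. A t k * ((real n / A t m) powr (1 / real m) * y) ^ k)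
    = real n * (\<Sum>k=1..m. b k * (s n ^ (m - k) * y ^ k))"
  unfolding sum_distrib_left
proof (intro sum.cong refl)
  fix k assume k: "k \<in> {1..m}"
  have "((real n / A t m) powr (1 / real m)) ^ k = real n powr (real k / real m) * A t m powr (- real k / real m)"
    using assms A_pos by (simp add: powr_powr powr_divide powr_minus_divide flip: powr_realpow)
  moreover have "real n * s n ^ (m - k) = real n powr (real k / real m)"
  proof -
    have "real n * s n ^ (m - k) = real n powr (1 + - real (m - k) / real m)"
      using assms by (simp add: s_power powr_mult_base)
    also have "1 + - real (m - k) / real m = real k / real m"
      using k m by (simp add: of_nat_diff field_simps)
    finally show ?thesis .
  qed
  ultimately show "A t k * ((real n / A t m) powr (1 / real m) * y) ^ k = real n * (b k * (s n ^ (m - k) * y ^ k))"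
    by (simp add: b_def power_mult_distrib mult_ac)
qed

lemma poly_subst_poly: "poly (subst_poly b m F) x = (\<Sum>k=1..m. b k * (x ^ (m - k) * poly F x ^ k))"
  by (simp add: subst_poly_def poly_sum poly_monom)

text \<open>Divided by n, the residual of 4\<beta> is O(1/n) = O(s^m). Replacing \<beta>/\<kappa> by
  its truncation \<open>G m\<close> costs another O(1/n), because both are bounded and differ by
  O(1/n).\<close>

lemma subst_poly_G_residual:
  assumes residual: "(\<lambda>n. (\<Sum>k=1..m. A t k * (4 * \<beta> n) ^ k) - real n) \<in> O(\<lambda>_. 1)"
  shows "(\<lambda>n. poly (subst_poly b m (G m) - 1) (s n)) \<in> O(\<lambda>n. s n ^ m)"
proof -
  define y where "y n = \<beta> n / \<kappa> n" for n
  define z where "z n = poly (G m) (s n)" for n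
  define E where "E n x = (\<Sum>k=1..m. b k * (s n ^ (m - k) * x ^ k))" for n x
  have pos: "\<forall>\<^sub>F n :: nat in sequentially. n > 0" by (rule eventually_gt_at_top)
  have z_lim: "z \<longlonglongrightarrow> poly (G m) 0"
    unfolding z_def[abs_def] by (intro tendsto_intros s_tendsto_0)
  have z_bdd: "z \<in> O(\<lambda>_. 1)" by (rule bigoI_tendsto[OF _ ]) (use z_lim in auto)
  have y_bdd: "y \<in> O(\<lambda>_. 1)"
    unfolding y_def[abs_def] by (rule bigoI_tendsto[OF _ ]) (use ratio_\<kappa>_tendsto in auto)
  have s_bdd: "(\<lambda>n. s n ^ k) \<in> O(\<lambda>_. 1)" for k
    by (rule bigoI_tendsto[of _ _ "0 ^ k"]) (auto intro!: tendsto_intros s_tendsto_0)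
  \<comment> \<open>\<open>G m\<close> contains exactly the powers 1 to m - 1 that
    \<open>near_remainder\<close> subtracts.\<close>
  have "near (\<lambda>n. (\<beta> n / \<kappa> n - (\<Sum>i=1..m-1. a i * real n powr (- real i / real m))) + (- 1)) (1 + (- 1))"
    by (intro near_add near_remainder near_const)
  moreover have "\<forall>\<^sub>F n in sequentially.
      (\<beta> n / \<kappa> n - (\<Sum>i=1..m-1. a i * real n powr (- real i / real m))) + (- 1) = y n - z n"
    using pos
  proof eventually_elim
    case (elim n)
    have "{1..m-1} = {1..<m}" using m by auto
    then show ?case using elim by (simp add: y_def z_def poly_G)
  qed
  ultimately have yz: "near (\<lambda>n. y n - z n) 0" using near_cong by force
  have "(\<lambda>n. E n (y n) - 1) \<in> O(\<lambda>n. 1 / real n)"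
  proof -
    have "(\<lambda>n. ((\<Sum>k=1..m. A t k * (4 * \<beta> n) ^ k) - real n) * (1 / real n)) \<in> O(\<lambda>n. 1 * (1 / real n))"
      by (intro landau_o.big.mult residual) simp
    moreover have "\<forall>\<^sub>F n in sequentially.
        ((\<Sum>k=1..m. A t k * (4 * \<beta> n) ^ k) - real n) * (1 / real n) = E n (y n) - 1"
      using pos
    proof eventually_elim
      case (elim n)
      have "4 * \<beta> n = (real n / A t m) powr (1 / real m) * y n"
        using \<kappa>_pos[OF elim] by (simp add: y_def flip: four_\<kappa>)
      then have "(\<Sum>k=1..m. A t k * (4 * \<beta> n) ^ k) = real n * E n (y n)"
        using sum_scaled[OF elim] by (simp add: E_def)
      then show ?case using elim by (simp add: field_simps)
    qed
    ultimately show ?thesis by (subst (asm) landau_o.big.in_cong) simp_all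
  qed
  moreover have "(\<lambda>n. \<Sum>k=1..m. b k * (s n ^ (m - k) * (y n ^ k - z n ^ k))) \<in> O(\<lambda>n. 1 / real n)"
  proof (rule big_sum_in_bigo)
    fix k
    have "(\<lambda>n. b k * (s n ^ (m - k) * (y n ^ k - z n ^ k))) \<in> O(\<lambda>n. 1 * (1 * (1 / real n)))"
      by (intro landau_o.big.mult bigo_const s_bdd near_power_diff yz y_bdd z_bdd)
    then show "(\<lambda>n. b k * (s n ^ (m - k) * (y n ^ k - z n ^ k))) \<in> O(\<lambda>n. 1 / real n)" by simp
  qed
  ultimately have "(\<lambda>n. (E n (y n) - 1) - (\<Sum>k=1..m. b k * (s n ^ (m - k) * (y n ^ k - z n ^ k))))
      \<in> O(\<lambda>n. 1 / real n)" by (rule sum_in_bigo)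
  moreover have "(E n (y n) - 1) - (\<Sum>k=1..m. b k * (s n ^ (m - k) * (y n ^ k - z n ^ k)))
      = poly (subst_poly b m (G m) - 1) (s n)" for n
    by (simp add: E_def poly_subst_poly z_def right_diff_distrib sum_subtractf)
  ultimately have "(\<lambda>n. poly (subst_poly b m (G m) - 1) (s n)) \<in> O(\<lambda>n. 1 / real n)"
    by (simp only:)
  also have "(\<lambda>n. 1 / real n) \<in> O(\<lambda>n. s n ^ m)"
    using pos by (intro bigoI[of _ 1], eventually_elim) (simp add: s_power_m)
  finally show ?thesis .
qed

text \<open>All coefficients of \<open>subst_poly b m (G m) - 1\<close> below order m vanish.
  Writing \<open>G m\<close> as \<open>G j\<close> plus a tail that starts with a_j X^j, the
  perturbation lemma gives 0 = (coefficient from \<open>G j\<close>) + m a_j at order j.\<close>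

lemma coefficient_recursion:
  assumes residual: "(\<lambda>n. (\<Sum>k=1..m. A t k * (4 * \<beta> n) ^ k) - real n) \<in> O(\<lambda>_. 1)"
    and j: "1 \<le> j" "j < m"
  shows "(\<lambda>n. (\<Sum>k=1..m. A t k * u_partial m t a j x n ^ k) - real n)
      \<in> O(\<lambda>n. real n powr (1 - real (j + 1) / real m)) \<longleftrightarrow> x = a j"
    and "a j = - fps_nth (eq_series m t (1 + (\<Sum>i=1..<j. fps_const (a i) * fps_X ^ i))) j / real m"
proof -
  define R where "R = (\<Sum>i=j..<m. monom (a i) (i - j))"
  have "{1..<m} = {1..<j} \<union> {j..<m}" using j by auto
  then have "(\<Sum>i=1..<m. monom (a i) i) = (\<Sum>i=1..<j. monom (a i) i) + (\<Sum>i=j..<m. monom (a i) i)"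
    by (simp add: sum.union_disjoint ivl_disj_int)
  also have "(\<Sum>i=j..<m. monom (a i) i) = monom 1 j * R"
    by (simp add: R_def sum_distrib_left mult_monom)
  finally have G_m: "G m = G j + monom 1 j * R" by (simp add: G_def)
  have "coeff R 0 = (\<Sum>i=j..<m. if i = j then a j else 0)"
    unfolding R_def coeff_sum by (intro sum.cong refl) (auto simp: coeff_monom)
  then have R_0: "coeff R 0 = a j" using j by simp
  note perturb = coeff_subst_poly_perturb[where b = b and m = m and j = j, OF coeff_G_0 j(1) m b_m]
  have zero: "coeff (subst_poly b m (G m) - 1) i = 0" if "i < m" for i
    using subst_poly_G_residual[OF residual] that
    by (simp only: poly_bigo_power_iff[OF s_tendsto_0 s_nonzero])
  have low: "coeff (subst_poly b m (G j) - 1) i = 0" if "i < j" for i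
    using zero[of i] perturb(1)[OF that, of j R] that j by (simp add: G_m)
  have at_j: "coeff (subst_poly b m (G j)) j = - (real m * a j)"
    using zero[of j] perturb(2)[of j R] j by (simp add: G_m R_0)
  then show "a j = - fps_nth (eq_series m t (1 + (\<Sum>i=1..<j. fps_const (a i) * fps_X ^ i))) j / real m"
    using m unfolding fps_of_poly_G[symmetric] fps_of_poly_subst_poly[symmetric] by simp
  \<comment> \<open>With the trial value x in place of a_j, the lower coefficients still vanish and
    the one at order j becomes m (x - a_j).\<close>
  define H where "H = subst_poly b m (G j + monom 1 j * [:x:]) - 1"
  have H_low: "coeff H i = 0" if "i < j" for i
    using low[OF that] perturb(1)[OF that, of j "[:x:]"] by (simp add: H_def)
  have H_j: "coeff H j = real m * (x - a j)"
    using perturb(2)[of j "[:x:]"] j at_j by (simp add: H_def algebra_simps)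
  have "(\<forall>i<Suc j. coeff H i = 0) \<longleftrightarrow> coeff H j = 0"
    using H_low by (auto simp: less_Suc_eq)
  also have "\<dots> \<longleftrightarrow> x = a j" using m by (simp add: H_j)
  finally have iff: "(\<forall>i<Suc j. coeff H i = 0) \<longleftrightarrow> x = a j" .
  have pos: "\<forall>\<^sub>F n :: nat in sequentially. n > 0" by (rule eventually_gt_at_top)
  have lhs: "\<forall>\<^sub>F n in sequentially.
      (\<Sum>k=1..m. A t k * u_partial m t a j x n ^ k) - real n = real n * poly H (s n)"
    using pos
  proof eventually_elim
    case (elim n)
    have "u_partial m t a j x n = (real n / A t m) powr (1 / real m) * poly (G j + monom 1 j * [:x:]) (s n)"
      using elim by (simp add: u_partial_def poly_G poly_monom s_power mult_ac)
    then show ?case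
      unfolding H_def using sum_scaled[OF elim]
      by (simp add: poly_subst_poly right_diff_distrib)
  qed
  \<comment> \<open>The exponent in the claim is that of n s^(j+1); the factor n cancels below and
    leaves O(s^(j+1)), which tests exactly the coefficients up to order j.\<close>
  have rhs: "\<forall>\<^sub>F n in sequentially. real n powr (1 - real (j + 1) / real m) = real n * s n ^ Suc j"
    using pos
  proof eventually_elim
    case (elim n)
    have "real n powr (1 - real (j + 1) / real m) = real n powr (1 + - real (Suc j) / real m)"
      by (simp only: minus_divide_left diff_conv_add_uminus Suc_eq_plus1)
    also have "\<dots> = real n * s n ^ Suc j"
      unfolding s_power[OF elim] powr_add using elim by simp
    finally show ?case .
  qed
  have nz: "\<forall>\<^sub>F n in sequentially. real n \<noteq> 0"
    using pos by eventually_elim simp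
  have "(\<lambda>n. (\<Sum>k=1..m. A t k * u_partial m t a j x n ^ k) - real n)
      \<in> O(\<lambda>n. real n powr (1 - real (j + 1) / real m))
      \<longleftrightarrow> (\<lambda>n. real n * poly H (s n)) \<in> O(\<lambda>n. real n * s n ^ Suc j)"
    by (rule landau_o.big.in_cong[OF lhs, THEN trans]) (simp only: landau_o.big.cong[OF rhs])
  also have "\<dots> \<longleftrightarrow> (\<lambda>n. poly H (s n)) \<in> O(\<lambda>n. s n ^ Suc j)"
    by (rule landau_o.big.mult_cancel_left[OF bigtheta_refl nz])
  also have "\<dots> \<longleftrightarrow> x = a j"
    unfolding poly_bigo_power_iff[OF s_tendsto_0 s_nonzero] iff ..
  finally show "(\<lambda>n. (\<Sum>k=1..m. A t k * u_partial m t a j x n ^ k) - real n)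
      \<in> O(\<lambda>n. real n powr (1 - real (j + 1) / real m)) \<longleftrightarrow> x = a j" .
qed

end

section \<open>The even potential of the weight and the final assembly\<close>

definition potential :: "nat \<Rightarrow> (nat \<Rightarrow> real) \<Rightarrow> real poly" where
  "potential m t = (\<Sum>k=1..m. monom (t k) (2 * k))"

lemma weight_eq_potential: "weight m t x = exp (- poly (potential m t) x)"
  by (simp add: weight_def potential_def poly_sum poly_monom)

text \<open>After subtraction of (t_m/2) x^2 the rest \<open>Q\<close> is an even polynomial with
  positive leading coefficient, hence bounded below: on x \<ge> 0 it is nonnegative beyond some
  \<open>N\<close> and bounded on [0, N].\<close>

lemma exp_weight_potential:
  assumes "m \<ge> 1" "t m > 0"
  shows "exp_weight (potential m t)"
proof
  \<comment> \<open>Half of t_m is taken so that the leading coefficient stays positive for m = 1,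
    where x^2 is itself the top power.\<close>
  define Q where "Q = potential m t - monom (t m / 2) 2"
  have even: "poly Q (\<bar>x\<bar>) = poly Q x" for x
    by (simp add: Q_def potential_def poly_sum poly_monom power_even_abs)
  have "coeff Q (2 * m) \<ge> t m / 2"
    using assms by (auto simp: Q_def potential_def coeff_sum coeff_monom if_distrib sum.delta)
  then have coeff: "coeff Q (2 * m) > 0" using assms by simp
  have "degree Q \<le> 2 * m"
    unfolding Q_def potential_def
    by (intro degree_diff_le degree_sum_le order.trans[OF degree_monom_le]) (use assms in auto)
  then have "degree Q = 2 * m" using coeff le_degree[of Q "2 * m"] by simp
  then have "lead_coeff Q > 0" using coeff by simp
  then obtain N where N: "\<And>x. x \<ge> N \<Longrightarrow> poly Q x \<ge> 0"
    using poly_pinfty_gt_lc[of Q] by force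
  have "bounded (poly Q ` {0..N})"
    by (intro compact_imp_bounded compact_continuous_image continuous_intros compact_Icc)
  then obtain C where C: "\<And>x. x \<in> {0..N} \<Longrightarrow> \<bar>poly Q x\<bar> \<le> C"
    unfolding bounded_real by blast
  have lower: "- max C 0 \<le> poly Q \<bar>x\<bar>" for x
    using N[of "\<bar>x\<bar>"] C[of "\<bar>x\<bar>"] by (cases "\<bar>x\<bar> \<ge> N") auto
  have "t m / 2 * x\<^sup>2 - max C 0 \<le> poly (potential m t) x" for x
    using lower[of x] unfolding even[of x] by (simp add: Q_def poly_monom algebra_simps)
  then show "\<exists>c>0. \<exists>C. \<forall>x. c * x\<^sup>2 - C \<le> poly (potential m t) x"
    using assms by (intro exI[of _ "t m / 2"] conjI exI[of _ "max C 0"]) auto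
qed

lemma freud_potential:
  assumes "m \<ge> 1" "t m > 0" "monic_orthogonal (weight m t) P" "recurrence_coeffs P \<beta>"
  shows "freud (potential m t) P \<beta>"
proof -
  interpret exp_weight "potential m t" using assms by (intro exp_weight_potential)
  show ?thesis
  proof unfold_locales
    show "degree (P n) = n" "lead_coeff (P n) = 1" for n
      using assms(3) unfolding monic_orthogonal_def by blast+
    show "L (P i * P j) = 0" if "i \<noteq> j" for i j
      using assms(3) that by (simp add: monic_orthogonal_def weight_eq_potential L_def)
  qed (rule assms(4))
qed

theorem lemma2:
  fixes m :: nat and t :: "nat \<Rightarrow> real" and P :: "nat \<Rightarrow> real poly"
    and \<beta> a :: "nat \<Rightarrow> real"
  assumes "m \<ge> 1" and "t m > 0"
    and "monic_orthogonal (weight m t) P"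
    and "recurrence_coeffs P \<beta>"
    and "has_expansion m t \<beta> a"
  shows "(\<forall>\<^sub>F n in sequentially. \<exists>!u. u > 0 \<and> (\<Sum>k=1..m. A t k * u ^ k) = real n) \<and>
    (\<lambda>n. \<beta> n / (u_sol m t n / 4) - 1) \<in> O(\<lambda>n. 1 / real n) \<and>
    (\<forall>j\<in>{1..m - 2}.
       (\<forall>x. (\<lambda>n. (\<Sum>k=1..m. A t k * u_partial m t a j x n ^ k) - real n)
              \<in> O(\<lambda>n. real n powr (1 - real (j + 1) / real m)) \<longleftrightarrow> x = a j) \<and>
       a j = - fps_nth (eq_series m t (1 + (\<Sum>i=1..<j. fps_const (a i) * fps_X ^ i))) j / real m)"
proof (intro conjI ballI allI)
  interpret freud "potential m t" P \<beta> using assms by (intro freud_potential)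
  interpret expansion m t \<beta> a using assms by unfold_locales
  \<comment> \<open>Orthogonality enters here through the string equation; both the error bound and
    the recursion rest on this estimate.\<close>
  have residual: "(\<lambda>n. (\<Sum>k=1..m. A t k * (4 * \<beta> n) ^ k) - real n) \<in> O(\<lambda>_. 1)"
    by (intro residual_bounded string_equation m) (simp add: potential_def)
  show "\<forall>\<^sub>F n in sequentially. \<exists>!u. u > 0 \<and> (\<Sum>k=1..m. A t k * u ^ k) = real n"
    using eventually_unique_positive_root[of m "A t"] m A_pos by blast
  have "near (\<lambda>n. 4 * \<beta> n / u_sol m t n) 1"
    unfolding u_sol_def
    by (intro near_root m A_pos residual filterlim_four_mult bigo_four_mult_power)
  then show "(\<lambda>n. \<beta> n / (u_sol m t n / 4) - 1) \<in> O(\<lambda>n. 1 / real n)"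
    by (simp add: near_def mult.commute)
  fix j assume "j \<in> {1..m - 2}"
  \<comment> \<open>With truncated subtraction the range is empty for m \<le> 2; otherwise j \<le> m
    - 2 gives j < m.\<close>
  then have j: "1 \<le> j" "j < m" by auto
  show "(\<lambda>n. (\<Sum>k=1..m. A t k * u_partial m t a j x n ^ k) - real n)
      \<in> O(\<lambda>n. real n powr (1 - real (j + 1) / real m)) \<longleftrightarrow> x = a j" for x
    by (rule coefficient_recursion(1)[OF residual j])
  show "a j = - fps_nth (eq_series m t (1 + (\<Sum>i=1..<j. fps_const (a i) * fps_X ^ i))) j / real m"
    by (rule coefficient_recursion(2)[OF residual j])
qed

end
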